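(* Let $p$ be an odd prime and $k$ a field of characteristic $p$. Let $g \in k[[\zeta]]$ be a power series satisfying $$g(\zeta) \equiv \zeta\left(1 + a_2\zeta^2 + a_3\zeta^3 + a_4\zeta^4\right) \mod \langle \zeta^6 \rangle$$ with $a_2, a_3, a_4 \in k$. Then $$g^p(\zeta) - \zeta \equiv a_2^{p-2}\left(\tfrac{3}{2}a_2^3 + a_3^2 - a_2a_4\right)\zeta^{2p+3} \mod \langle \zeta^{2p+4} \rangle.$$
   Context: $g^p$ denotes the $p$-fold composition of $g$ with itself. $\langle \zeta^m \rangle$ denotes the ideal of $k[[\zeta]]$ generated by $\zeta^m$. *)

theory Defs
  imports "HOL-Computational_Algebra.Formal_Power_Series"
begin

primrec fps_iterate :: "nat \<Rightarrow> 'a::comm_ring_1 fps \<Rightarrow> 'a fps" where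
  "fps_iterate 0 g = fps_X"
| "fps_iterate (Suc n) g = g oo fps_iterate n g"
  (* fps_compose is only meaningful for an inner series without constant term,
     so this is the n-fold composition for g with g $ 0 = 0. *)

definition fps_X_ideal :: "nat \<Rightarrow> 'a::comm_ring_1 fps set" where
  "fps_X_ideal m = {q * fps_X ^ m | q. True}"

definition fps_cong :: "'a::comm_ring_1 fps \<Rightarrow> 'a fps \<Rightarrow> nat \<Rightarrow> bool"
    ("(_ \<equiv>\<^sub>X _ mod \<langle>X^_\<rangle>)" [51, 51, 1000] 50) where
  "f \<equiv>\<^sub>X h mod \<langle>X^m\<rangle> \<longleftrightarrow> f - h \<in> fps_X_ideal m"

end

theory Submission
  imports Defs "HOL-Number_Theory.Residues"
begin

text \<open>
  Put \<open>D\<^sub>0 = X\<close> and \<open>D\<^sub>m\<^sub>+\<^sub>1 = D\<^sub>m \<circ> g - D\<^sub>m\<close>. Newton's forward difference formula expresses the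
  iterates of \<open>g\<close> as \<open>g\<^sup>n = (\<Sum>i\<le>n. (n choose i) D\<^sub>i)\<close>, so \<open>g\<^sup>p = X + D\<^sub>p\<close> in characteristic \<open>p\<close>.
  Each difference raises the order by at least 2, and the coefficients of \<open>D\<^sub>m\<close> at
  \<open>2m + 1\<close>, \<open>2m + 2\<close>, \<open>2m + 3\<close> obey a triangular linear recursion with closed-form solution.
  At \<open>m = p\<close> every term with a factor \<open>p\<close> vanishes; the products of residues that survive
  are evaluated by Wilson's theorem.
\<close>

unbundle fps_syntax

section \<open>Congruence modulo a power of X\<close>

lemma fps_cong_iff_nth:
  fixes f h :: "'a::comm_ring_1 fps"
  shows "f \<equiv>\<^sub>X h mod \<langle>X^m\<rangle> \<longleftrightarrow> (\<forall>n<m. f $ n = h $ n)"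
proof
  assume "f \<equiv>\<^sub>X h mod \<langle>X^m\<rangle>"
  then obtain q where q: "f - h = q * fps_X ^ m"
    by (auto simp: fps_cong_def fps_X_ideal_def)
  show "\<forall>n<m. f $ n = h $ n"
  proof (intro allI impI)
    fix n assume "n < m"
    then have "(f - h) $ n = 0"
      by (simp add: q fps_X_power_mult_right_nth)
    then show "f $ n = h $ n" by simp
  qed
next
  assume *: "\<forall>n<m. f $ n = h $ n"
  have "f - h = fps_shift m (f - h) * fps_X ^ m"
    by (rule fps_ext) (use * in \<open>auto simp: fps_X_power_mult_right_nth\<close>)
  then show "f \<equiv>\<^sub>X h mod \<langle>X^m\<rangle>"
    by (auto simp: fps_cong_def fps_X_ideal_def)
qed

section \<open>Iterated forward differences of composition\<close>

primrec fps_comp_diff :: "'a::idom fps \<Rightarrow> nat \<Rightarrow> 'a fps" where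
  "fps_comp_diff g 0 = fps_X"
| "fps_comp_diff g (Suc m) = (fps_comp_diff g m oo g) - fps_comp_diff g m"

lemma fps_iterate_nth_0:
  fixes g :: "'a::comm_ring_1 fps"
  assumes "g $ 0 = 0"
  shows "fps_iterate n g $ 0 = 0"
  using assms by (cases n) (simp_all add: fps_compose_nth)

text \<open>\<open>fps_iterate\<close> puts the new \<open>g\<close> outside, while the differences
  compose with \<open>g\<close> inside; associativity reconciles the two because all iterates have
  zero constant term.\<close>

lemma fps_iterate_Suc_right:
  fixes g :: "'a::idom fps"
  assumes "g $ 0 = 0"
  shows "fps_iterate (Suc n) g = fps_iterate n g oo g"
proof (induction n)
  case 0
  show ?case using assms by simp
next
  case (Suc n)
  have "fps_iterate (Suc (Suc n)) g = g oo (fps_iterate n g oo g)"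
    using Suc by simp
  also have "\<dots> = fps_iterate (Suc n) g oo g"
    using assms by (simp add: fps_compose_assoc fps_iterate_nth_0)
  finally show ?case .
qed

text \<open>Right composition with \<open>g\<close> is additive and equals identity plus difference
  operator, so its n-th power expands binomially; the induction step is Pascal's rule.\<close>

lemma fps_iterate_eq_sum_comp_diff:
  fixes g :: "'a::idom fps"
  assumes "g $ 0 = 0"
  shows "fps_iterate n g = (\<Sum>i\<le>n. of_nat (n choose i) * fps_comp_diff g i)"
proof (induction n)
  case 0
  show ?case by simp
next
  case (Suc n)
  let ?D = "fps_comp_diff g"
  have comp_of_nat: "(of_nat c * f) oo g = of_nat c * (f oo g)" for c :: nat and f
    by (induction c) (simp_all add: fps_compose_add_distrib distrib_right)
  have "fps_iterate (Suc n) g = (\<Sum>i\<le>n. of_nat (n choose i) * (?D i oo g))"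
    unfolding fps_iterate_Suc_right[OF assms] Suc fps_compose_sum_distrib comp_of_nat ..
  also have "\<dots> = (\<Sum>i\<le>n. of_nat (n choose i) * ?D i) + (\<Sum>i\<le>n. of_nat (n choose i) * ?D (Suc i))"
    by (simp add: sum.distrib[symmetric] algebra_simps)
  also have "(\<Sum>i\<le>n. of_nat (n choose i) * ?D i) =
      ?D 0 + (\<Sum>i\<le>n. of_nat (n choose Suc i) * ?D (Suc i))"
  proof -
    \<comment> \<open>The added term has coefficient \<open>n choose Suc n\<close>, which is 0; it
      makes the range fit the index shift.\<close>
    have "(\<Sum>i\<le>n. of_nat (n choose i) * ?D i) = (\<Sum>i\<le>Suc n. of_nat (n choose i) * ?D i)"
      by (simp del: fps_comp_diff.simps add: binomial_eq_0)
    also have "\<dots> = ?D 0 + (\<Sum>i\<le>n. of_nat (n choose Suc i) * ?D (Suc i))"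
      by (subst sum.atMost_Suc_shift) simp
    finally show ?thesis .
  qed
  also have "?D 0 + (\<Sum>i\<le>n. of_nat (n choose Suc i) * ?D (Suc i))
      + (\<Sum>i\<le>n. of_nat (n choose i) * ?D (Suc i))
    = (\<Sum>i\<le>Suc n. of_nat (Suc n choose i) * ?D i)"
    by (subst sum.atMost_Suc_shift) (simp add: sum.distrib distrib_right add_ac)
  finally show ?case .
qed

lemma fps_iterate_CHAR:
  fixes g :: "'a::idom fps"
  assumes "g $ 0 = 0" and "prime p" and "CHAR('a) = p"
  shows "fps_iterate p g = fps_X + fps_comp_diff g p"
proof -
  let ?t = "\<lambda>i. of_nat (p choose i) * fps_comp_diff g i"
  have p: "p > 0" using assms(2) by (rule prime_gt_0_nat)
  have "?t i = 0" if "i \<in> {..p} - {0, p}" for i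
  proof -
    have "p dvd (p choose i)"
      using that assms(2) by (intro dvd_choose_prime) auto
    then have "of_nat (p choose i) = (0 :: 'a)"
      using assms(3) by (simp add: of_nat_eq_0_iff_char_dvd)
    then have "of_nat (p choose i) = (0 :: 'a fps)"
      by (metis fps_of_nat fps_const_0_eq_0)
    then show ?thesis by simp
  qed
  then have "(\<Sum>i\<le>p. ?t i) = (\<Sum>i\<in>{0, p}. ?t i)"
    by (intro sum.mono_neutral_right) auto
  then show ?thesis
    using p by (simp add: fps_iterate_eq_sum_comp_diff[OF assms(1)])
qed

section \<open>Leading coefficients of the differences\<close>

text \<open>Write v = 1 + u with u of order at least 2: in the expansion of (1 + u)^i the square of
  u first contributes in degree 4, and higher powers of u only in degree 6 or more.\<close>

lemma fps_power_low_nth: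
  fixes v :: "'a::comm_ring_1 fps"
  assumes "v $ 0 = 1" and "v $ 1 = 0"
  shows "(v ^ i) $ 0 = 1" and "(v ^ i) $ 1 = 0"
    and "(v ^ i) $ 2 = of_nat i * v $ 2" and "(v ^ i) $ 3 = of_nat i * v $ 3"
    and "(v ^ i) $ 4 = of_nat i * v $ 4 + of_nat (i choose 2) * (v $ 2)\<^sup>2"
proof -
  have "(v ^ i) $ 0 = 1 \<and> (v ^ i) $ 1 = 0
    \<and> (v ^ i) $ 2 = of_nat i * v $ 2 \<and> (v ^ i) $ 3 = of_nat i * v $ 3
    \<and> (v ^ i) $ 4 = of_nat i * v $ 4 + of_nat (i choose 2) * (v $ 2)\<^sup>2"
  proof (induction i)
    case 0
    show ?case by (simp add: numeral_2_eq_2)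
  next
    case (Suc i)
    have choose: "Suc i choose 2 = i + (i choose 2)"
      by (simp add: numeral_2_eq_2)
    show ?case
      using Suc assms unfolding choose power_Suc fps_mult_nth
      by (simp add: numeral_eq_Suc atLeast0_atMost_Suc algebra_simps)
  qed
  then show "(v ^ i) $ 0 = 1" and "(v ^ i) $ 1 = 0"
    and "(v ^ i) $ 2 = of_nat i * v $ 2" and "(v ^ i) $ 3 = of_nat i * v $ 3"
    and "(v ^ i) $ 4 = of_nat i * v $ 4 + of_nat (i choose 2) * (v $ 2)\<^sup>2"
    by auto
qed

text \<open>Composition turns X^i into X^i v^i. Subtracting \<open>f\<close> cancels the diagonal
  terms, as \<open>v ^ i\<close> has constant coefficient 1, and the next ones vanish, as
  \<open>v ^ i\<close> has no linear term; hence the gain of 2 in order.\<close>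

lemma fps_compose_diff_nth:
  fixes f v :: "'a::idom fps" and N :: nat
  assumes v: "v $ 0 = 1" "v $ 1 = 0" and f: "\<And>n. n < N \<Longrightarrow> f $ n = 0"
  defines "h \<equiv> (f oo (fps_X * v)) - f"
  shows "n < N + 2 \<Longrightarrow> h $ n = 0"
    and "h $ (N + 2) = of_nat N * v $ 2 * f $ N"
    and "h $ (N + 3) = of_nat (N + 1) * v $ 2 * f $ (N + 1) + of_nat N * v $ 3 * f $ N"
    and "h $ (N + 4) = of_nat (N + 2) * v $ 2 * f $ (N + 2) + of_nat (N + 1) * v $ 3 * f $ (N + 1)
           + (of_nat N * v $ 4 + of_nat (N choose 2) * (v $ 2)\<^sup>2) * f $ N"
proof -
  have pow: "(fps_X * v) ^ i $ k = (if k < i then 0 else (v ^ i) $ (k - i))" for i k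
    by (simp add: power_mult_distrib fps_X_power_mult_nth)
  have comp: "h $ k = (\<Sum>i=0..<k. f $ i * (v ^ i) $ (k - i))" for k
  proof -
    have "(f oo (fps_X * v)) $ k = (\<Sum>i=0..k. f $ i * (v ^ i) $ (k - i))"
      unfolding fps_compose_nth by (intro sum.cong) (auto simp: pow)
    also have "{0..k} = insert k {0..<k}" by auto
    finally show ?thesis
      by (simp add: h_def fps_power_low_nth[OF v])
  qed
  \<comment> \<open>Only indices from \<open>N\<close> on contribute, so the sum has
    \<open>k\<close> terms however large \<open>N\<close> is.\<close>
  have tail: "h $ (N + k) = (\<Sum>i<k. f $ (N + i) * (v ^ (N + i)) $ (k - i))" for k
  proof -
    have "h $ (N + k) = (\<Sum>i=N..<N+k. f $ i * (v ^ i) $ (N + k - i))"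
      unfolding comp
      by (rule sum.mono_neutral_cong_right) (auto simp: f)
    also have "\<dots> = (\<Sum>i<k. f $ (N + i) * (v ^ (N + i)) $ (k - i))"
      by (rule sum.reindex_bij_witness[of _ "\<lambda>i. N + i" "\<lambda>i. i - N"]) (auto simp: add.commute)
    finally show ?thesis .
  qed
  note pw = fps_power_low_nth[OF v]
  show "h $ n = 0" if "n < N + 2"
  proof (cases "n \<le> N")
    case True
    then show ?thesis unfolding comp by (intro sum.neutral) (simp add: f)
  next
    case False
    then have "n = N + 1" using that by simp
    then show ?thesis using tail[of 1] pw(2) by simp
  qed
  show "h $ (N + 2) = of_nat N * v $ 2 * f $ N"
    unfolding tail using pw v by (simp add: numeral_eq_Suc)
  show "h $ (N + 3) = of_nat (N + 1) * v $ 2 * f $ (N + 1) + of_nat N * v $ 3 * f $ N"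
    unfolding tail using v pw[of N] pw[of "N+1"] pw[of "N+2"]
    by (simp add: numeral_eq_Suc algebra_simps)
  show "h $ (N + 4) = of_nat (N + 2) * v $ 2 * f $ (N + 2) + of_nat (N + 1) * v $ 3 * f $ (N + 1)
           + (of_nat N * v $ 4 + of_nat (N choose 2) * (v $ 2)\<^sup>2) * f $ N"
    unfolding tail using v pw[of N] pw[of "N+1"] pw[of "N+2"] pw[of "N+3"]
    by (simp add: numeral_eq_Suc algebra_simps)
qed

lemma fps_comp_diff_nth_rec:
  fixes v :: "'a::idom fps" and m :: nat
  assumes v: "v $ 0 = 1" "v $ 1 = 0"
  defines "D \<equiv> fps_comp_diff (fps_X * v)"
  shows "n < 2 * m + 1 \<Longrightarrow> D m $ n = 0"
    and "D (Suc m) $ (2 * m + 3) = of_nat (2 * m + 1) * v $ 2 * D m $ (2 * m + 1)"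
    and "D (Suc m) $ (2 * m + 4) = of_nat (2 * m + 2) * v $ 2 * D m $ (2 * m + 2)
           + of_nat (2 * m + 1) * v $ 3 * D m $ (2 * m + 1)"
    and "D (Suc m) $ (2 * m + 5) = of_nat (2 * m + 3) * v $ 2 * D m $ (2 * m + 3)
           + of_nat (2 * m + 2) * v $ 3 * D m $ (2 * m + 2)
           + of_nat (2 * m + 1) * (v $ 4 + of_nat m * (v $ 2)\<^sup>2) * D m $ (2 * m + 1)"
proof -
  have low: "D m $ n = 0" if "n < 2 * m + 1" for m n
    using that
  proof (induction m arbitrary: n)
    case 0
    then show ?case by (simp add: D_def)
  next
    case (Suc m)
    show ?case
      using fps_compose_diff_nth(1)[OF v, of "2 * m + 1" "D m" n] Suc by (simp add: D_def)
  qed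
  note step = fps_compose_diff_nth(2-)[OF v, of "2 * m + 1" "D m", OF low]
  \<comment> \<open>This exposes the common factor 2m+1, which later extends
    \<open>odd_prod m\<close> to \<open>odd_prod (Suc m)\<close>.\<close>
  have choose: "2 * m + 1 choose 2 = (2 * m + 1) * m"
    by (simp add: choose_two)
  show "n < 2 * m + 1 \<Longrightarrow> D m $ n = 0" by (rule low)
  show "D (Suc m) $ (2 * m + 3) = of_nat (2 * m + 1) * v $ 2 * D m $ (2 * m + 1)"
    using step(1) by (simp add: D_def numeral_eq_Suc)
  show "D (Suc m) $ (2 * m + 4) = of_nat (2 * m + 2) * v $ 2 * D m $ (2 * m + 2)
           + of_nat (2 * m + 1) * v $ 3 * D m $ (2 * m + 1)"
    using step(2) by (simp add: D_def numeral_eq_Suc)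
  have "D (Suc m) $ (2 * m + 5) = of_nat (2 * m + 3) * v $ 2 * D m $ (2 * m + 3)
           + of_nat (2 * m + 2) * v $ 3 * D m $ (2 * m + 2)
           + (of_nat (2 * m + 1) * v $ 4 + of_nat (2 * m + 1 choose 2) * (v $ 2)\<^sup>2) * D m $ (2 * m + 1)"
    using step(3) by (simp add: D_def numeral_eq_Suc)
  then show "D (Suc m) $ (2 * m + 5) = of_nat (2 * m + 3) * v $ 2 * D m $ (2 * m + 3)
           + of_nat (2 * m + 2) * v $ 3 * D m $ (2 * m + 2)
           + of_nat (2 * m + 1) * (v $ 4 + of_nat m * (v $ 2)\<^sup>2) * D m $ (2 * m + 1)"
    unfolding choose by (simp only: of_nat_mult distrib_left mult.assoc)
qed

section \<open>Solving the recursion\<close>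

text \<open>The double factorial (2m-1)!!, taken in the coefficient ring so that it can vanish
  there.\<close>

definition odd_prod :: "nat \<Rightarrow> 'a::comm_semiring_1" where
  "odd_prod m = (\<Prod>j<m. of_nat (2 * j + 1))"

text \<open>Likewise (2m)!!.\<close>

definition even_prod :: "nat \<Rightarrow> 'a::comm_semiring_1" where
  "even_prod m = (\<Prod>j<m. of_nat (2 * j + 2))"

lemma odd_prod_simps [simp]:
  "odd_prod 0 = 1" "odd_prod (Suc m) = odd_prod m * of_nat (2 * m + 1)"
  by (simp_all add: odd_prod_def)

lemma even_prod_simps [simp]:
  "even_prod 0 = 1" "even_prod (Suc m) = even_prod m * of_nat (2 * m + 2)"
  by (simp_all add: even_prod_def)

text \<open>The part of the third coefficient, stripped of its power of \<open>v $ 2\<close>, that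
  is driven by the source terms containing \<open>odd_prod (Suc m)\<close>; \<open>w m\<close>
  collects their cofactors.\<close>

primrec odd_rec :: "(nat \<Rightarrow> 'a::comm_semiring_1) \<Rightarrow> nat \<Rightarrow> 'a" where
  "odd_rec w 0 = 0"
| "odd_rec w (Suc m) = of_nat (2 * m + 3) * odd_rec w m + w m * odd_prod (Suc m)"

text \<open>
  The solution starts at \<open>m = 2\<close>: the third coefficient carries the factor \<open>(v $ 2) ^ (m - 2)\<close>,
  and the formula has to hold without dividing by \<open>v $ 2\<close>, which may be 0.
\<close>

lemma fps_comp_diff_nth_closed:
  fixes v :: "'a::idom fps" and n :: nat
  assumes v: "v $ 0 = 1" "v $ 1 = 0"
  defines "D \<equiv> fps_comp_diff (fps_X * v)" and "m \<equiv> n + 2"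
    and "w \<equiv> \<lambda>i. of_nat (2 * i + 2) * (v $ 3)\<^sup>2 + v $ 2 * v $ 4 + of_nat i * (v $ 2) ^ 3"
  shows "D m $ (2 * m + 1) = odd_prod m * (v $ 2) ^ m"
    and "D m $ (2 * m + 2) = v $ 3 * (v $ 2) ^ (n + 1) * (odd_prod (m + 1) - even_prod m)"
    and "D m $ (2 * m + 3) =
           (v $ 2) ^ n * (odd_rec w m - (v $ 3)\<^sup>2 * (even_prod (m + 1) - 2 * odd_prod (m + 1)))"
proof -
  have "D m $ (2 * m + 1) = odd_prod m * (v $ 2) ^ m
    \<and> D m $ (2 * m + 2) = v $ 3 * (v $ 2) ^ (n + 1) * (odd_prod (m + 1) - even_prod m)
    \<and> D m $ (2 * m + 3) =
        (v $ 2) ^ n * (odd_rec w m - (v $ 3)\<^sup>2 * (even_prod (m + 1) - 2 * odd_prod (m + 1)))"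
    unfolding m_def
  proof (induction n)
    case 0
    note rec = fps_comp_diff_nth_rec(2-)[OF v, folded D_def]
    show ?case
      \<comment> \<open>Two steps of the recursion lead from \<open>D 0\<close>, which is X, to
        \<open>D 2\<close>.\<close>
      using rec[of 0] rec[of 1]
      by (simp add: numeral_eq_Suc D_def w_def algebra_simps)
  next
    case (Suc n)
    define m where "m = n + 2"
    note rec = fps_comp_diff_nth_rec(2-)[OF v, folded D_def, of m]
    note IH = Suc[folded m_def]
    have idx: "Suc n + 2 = Suc m" "2 * Suc m + 1 = 2 * m + 3" "2 * Suc m + 2 = 2 * m + 4"
      "2 * Suc m + 3 = 2 * m + 5" "Suc m + 1 = Suc (Suc m)" "m + 1 = Suc m"
      by (simp_all add: m_def)
    have pw: "(v $ 2) ^ m = (v $ 2) ^ n * (v $ 2)\<^sup>2" by (simp add: m_def power_add power2_eq_square)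
    \<comment> \<open>The source left over from \<open>odd_rec\<close> demands x(m+1) = (2m+3) x(m)
      + \<open>even_prod (m + 1)\<close> for the cofactor x(m) of -(\<open>v $ 3\<close>)^2;
      \<open>even_prod (m + 1) - 2 * odd_prod (m + 1)\<close> solves this.\<close>
    show ?case
      unfolding idx rec using IH unfolding idx pw
      by (simp add: pw) (simp add: w_def algebra_simps power2_eq_square power3_eq_cube)
  qed
  then show "D m $ (2 * m + 1) = odd_prod m * (v $ 2) ^ m"
    and "D m $ (2 * m + 2) = v $ 3 * (v $ 2) ^ (n + 1) * (odd_prod (m + 1) - even_prod m)"
    and "D m $ (2 * m + 3) =
           (v $ 2) ^ n * (odd_rec w m - (v $ 3)\<^sup>2 * (even_prod (m + 1) - 2 * odd_prod (m + 1)))"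
    by auto
qed

section \<open>Evaluation in characteristic p\<close>

text \<open>The source \<open>w i\<close> enters with the odd factors up to 2i+1, and later steps
  multiply by 2i+5, ..., 2m+1: exactly the factor 2i+3 is skipped.\<close>

lemma odd_rec_eq_sum:
  "odd_rec w m = (\<Sum>i<m. w i * (\<Prod>j\<in>{..m} - {Suc i}. of_nat (2 * j + 1)))"
proof (induction m)
  case 0
  show ?case by simp
next
  case (Suc m)
  have "(\<Prod>j\<in>{..Suc m} - {Suc i}. of_nat (2 * j + 1))
      = of_nat (2 * m + 3) * (\<Prod>j\<in>{..m} - {Suc i}. of_nat (2 * j + 1) :: 'a)" if "i < m" for i
  proof -
    have "{..Suc m} - {Suc i} = insert (Suc m) ({..m} - {Suc i})" using that by auto
    moreover have "Suc m \<notin> {..m} - {Suc i}" and "2 * Suc m + 1 = 2 * m + 3" by simp_all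
    ultimately show ?thesis by (simp only: prod.insert finite_Diff finite_atMost simp_thms)
  qed
  moreover have "{..Suc m} - {Suc m} = {..<Suc m}" by auto
  ultimately show ?case
    unfolding odd_rec.simps Suc sum.lessThan_Suc odd_prod_def
    by (simp add: sum_distrib_left mult.left_commute)
qed

text \<open>Used at type \<open>nat\<close> and then cast, since \<open>fact\<close> needs
  characteristic 0.\<close>

lemma fact_double: "fact (2 * n) = (odd_prod n * even_prod n :: 'a::{comm_semiring_1, semiring_char_0})"
  by (induction n) (simp_all add: algebra_simps)

lemma fact_CHAR_minus_1:
  assumes "prime p" and "CHAR('a::comm_ring_1) = p"
  shows "(of_nat (fact (p - 1)) :: 'a) = - 1"
proof -
  have "[int (fact (p - 1)) = - 1] (mod int p)"
    using wilson_theorem[OF assms(1)] by simp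
  then have "(of_int (int (fact (p - 1))) :: 'a) = of_int (- 1)"
    using assms(2) by (simp only: of_int_eq_iff_cong_CHAR)
  then show ?thesis by (simp only: of_int_of_nat_eq of_int_minus of_int_1)
qed

text \<open>The omitted factor is p itself. The factors below it are 1, 3, ..., p-2; those from p+2
  to 2p-1 reduce to 2, 4, ..., p-1; the last, 2p+1, reduces to 1. Together they give (p-1)!, and
  Wilson's theorem applies.\<close>

lemma prod_odd_residues:
  fixes h :: nat
  assumes "prime p" and "CHAR('a::comm_ring_1) = p" and "p = 2 * h + 1"
  shows "(\<Prod>j\<in>{..p} - {h}. of_nat (2 * j + 1) :: 'a) = - 1"
proof -
  have p0: "of_nat p = (0 :: 'a)" using assms(2) by auto
  have "(\<Prod>j\<in>{..p} - {h}. of_nat (2 * j + 1) :: 'a)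
      = (\<Prod>j<h. of_nat (2 * j + 1)) * (\<Prod>j\<in>{h<..<p}. of_nat (2 * j + 1)) * of_nat (2 * p + 1)"
  proof -
    have "{..p} - {h} = insert p ({..<h} \<union> {h<..<p})" using assms(3) by auto
    moreover have "p \<notin> {..<h} \<union> {h<..<p}" using assms(3) by auto
    moreover have "{..<h} \<inter> {h<..<p} = {}" by auto
    ultimately show ?thesis by (simp add: prod.union_disjoint mult.commute)
  qed
  also have "(\<Prod>j\<in>{h<..<p}. of_nat (2 * j + 1) :: 'a) = (\<Prod>j<h. of_nat (2 * j + 2))"
  proof (rule prod.reindex_bij_witness[of _ "\<lambda>i. h + 1 + i" "\<lambda>j. j - (h + 1)"])
    fix j assume "j \<in> {h<..<p}"
    then have "2 * j + 1 = p + (2 * (j - (h + 1)) + 2)" using assms(3) by auto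
    then show "of_nat (2 * (j - (h + 1)) + 2) = (of_nat (2 * j + 1) :: 'a)"
      using p0 by (metis add_0 of_nat_add)
  qed (use assms(3) in auto)
  also have "(\<Prod>j<h. of_nat (2 * j + 1) :: 'a) * (\<Prod>j<h. of_nat (2 * j + 2))
      = of_nat (odd_prod h * even_prod h)"
    by (simp only: odd_prod_def even_prod_def of_nat_mult of_nat_prod of_nat_id)
  also have "\<dots> = of_nat (fact (p - 1))"
    using fact_double[of h, where ?'a = nat] assms(3) by simp
  also have "\<dots> = - 1" using assms(1,2) by (rule fact_CHAR_minus_1)
  also have "(of_nat (2 * p + 1) :: 'a) = 1" using p0 by simp
  finally show ?thesis by simp
qed

text \<open>The factor p = 2(i+1)+1 occurs in every summand except the one that skips it, so a
  single source term survives.\<close>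

lemma odd_rec_CHAR:
  fixes w :: "nat \<Rightarrow> 'a::comm_ring_1"
  assumes "prime p" and "CHAR('a) = p" and "p = 2 * i + 3"
  shows "odd_rec w p = - w i"
proof -
  have p: "of_nat (2 * Suc i + 1) = (0 :: 'a)"
    using assms(2,3) by (subst of_nat_eq_0_iff_char_dvd) (simp add: numeral_3_eq_3)
  have vanish: "(\<Prod>j\<in>{..p} - {Suc i'}. of_nat (2 * j + 1) :: 'a) = 0" if "i' \<noteq> i" for i'
    by (rule prod_zero) (use p that assms(3) in \<open>auto intro!: bexI[of _ "Suc i"]\<close>)
  have "odd_rec w p = (\<Sum>i'\<in>{i}. w i' * (\<Prod>j\<in>{..p} - {Suc i'}. of_nat (2 * j + 1)))"
    unfolding odd_rec_eq_sum
    by (rule sum.mono_neutral_right) (use vanish assms(3) in auto)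
  also have "\<dots> = - w i"
    using prod_odd_residues[OF assms(1,2), of "Suc i"] assms(3) by simp
  finally show ?thesis .
qed

lemma odd_prod_eq_0:
  assumes "CHAR('a::comm_ring_1) = 2 * h + 1" and "h < m"
  shows "odd_prod m = (0 :: 'a)"
proof -
  have "of_nat (2 * h + 1) = (0 :: 'a)"
    using assms(1) by (metis of_nat_CHAR)
  then show ?thesis
    unfolding odd_prod_def using assms(2) by (intro prod_zero) auto
qed

lemma even_prod_eq_0:
  assumes "CHAR('a::comm_ring_1) = p" and "0 < p" and "p \<le> m"
  shows "even_prod m = (0 :: 'a)"
proof -
  \<comment> \<open>The factor of index p-1 is 2p.\<close>
  have "2 * (p - 1) + 2 = p * 2" using assms(2) by simp
  then have "of_nat (2 * (p - 1) + 2) = (0 :: 'a)"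
    using assms(1) by (simp only: of_nat_eq_0_iff_char_dvd dvd_triv_left)
  then show ?thesis
    unfolding even_prod_def using assms(2,3) by (intro prod_zero) (auto intro!: bexI[of _ "p - 1"])
qed

theorem proposition1:
  fixes p :: nat and g :: "'k::field fps" and a2 a3 a4 :: 'k
  assumes "prime p" and "odd p" and "CHAR('k) = p"
    and "g \<equiv>\<^sub>X fps_X * (1 + fps_const a2 * fps_X ^ 2 + fps_const a3 * fps_X ^ 3
                       + fps_const a4 * fps_X ^ 4) mod \<langle>X^6\<rangle>"
  shows "fps_iterate p g - fps_X \<equiv>\<^sub>X
           fps_const (a2 ^ (p - 2) * ((3 / 2) * a2 ^ 3 + a3 ^ 2 - a2 * a4)) * fps_X ^ (2 * p + 3)
           mod \<langle>X^(2 * p + 4)\<rangle>"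
proof -
  define v where "v = fps_shift 1 g"
  have g_nth: "g $ n = (fps_X * (1 + fps_const a2 * fps_X ^ 2 + fps_const a3 * fps_X ^ 3
                       + fps_const a4 * fps_X ^ 4)) $ n" if "n < 6" for n
    using assms(4) that by (auto simp: fps_cong_iff_nth)
  have g0: "g $ 0 = 0" using g_nth[of 0] by simp
  have v: "v $ 0 = 1" "v $ 1 = 0" "v $ 2 = a2" "v $ 3 = a3" "v $ 4 = a4"
    using g_nth[of 1] g_nth[of 2] g_nth[of 3] g_nth[of 4] g_nth[of 5]
    by (simp_all add: v_def fps_X_power_iff flip: numeral_2_eq_2)
  have g: "g = fps_X * v"
    by (rule fps_ext) (simp add: v_def g0)
  have "p \<noteq> 1" using assms(1) by auto
  with assms(2) obtain h where "p = 2 * h + 1" "h \<noteq> 0" by (auto elim!: oddE)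
  \<comment> \<open>This \<open>i\<close> is the index of the one source term that survives in
    \<open>odd_rec\<close>.\<close>
  then obtain i where i: "p = 2 * i + 3" by (cases h) auto
  define n where "n = p - 2"
  have n: "p = n + 2" using i by (simp add: n_def)
  define D where "D = fps_comp_diff g"
  have p_field: "of_nat p = (0 :: 'k)" using assms(3) by auto
  have odd_0: "odd_prod m = (0 :: 'k)" if "p \<le> m" for m
    using odd_prod_eq_0[of "i + 1" m, where ?'a = 'k] that i assms(3) by simp
  have even_0: "even_prod m = (0 :: 'k)" if "p \<le> m" for m
    using even_prod_eq_0[OF assms(3)] that i by simp
  \<comment> \<open>The closed form at m = p has n = p-2, the exponent of \<open>a2\<close> in the
    claim.\<close>
  note closed = fps_comp_diff_nth_closed[OF v(1,2), of n, folded n g D_def]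
  have D1: "D p $ (2 * p + 1) = 0"
    unfolding closed by (simp add: odd_0)
  have D2: "D p $ (2 * p + 2) = 0"
    unfolding closed using odd_0[of "p + 1"] even_0[of p] by simp
  have two: "(2 :: 'k) \<noteq> 0"
  proof
    assume "(2 :: 'k) = 0"
    then have "of_nat 2 = (0 :: 'k)" by simp
    then have "p dvd 2" using assms(3) by (simp only: of_nat_eq_0_iff_char_dvd)
    then show False using i by (auto dest: dvd_imp_le)
  qed
  \<comment> \<open>Origin of the constant 3/2: i = (p-3)/2. It also makes 2i+2 equal to -1, which
    fixes the sign of the \<open>a3 ^ 2\<close> term in \<open>- w i\<close>.\<close>
  have i_field: "(of_nat i :: 'k) = - (3 / 2)"
    using p_field two by (simp add: i field_simps add_eq_0_iff)
  have D3: "D p $ (2 * p + 3) = a2 ^ (p - 2) * ((3 / 2) * a2 ^ 3 + a3 ^ 2 - a2 * a4)"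
    unfolding closed odd_rec_CHAR[OF assms(1,3) i] v
    using odd_0[of "p + 1"] even_0[of "p + 1"] two
    by (simp add: i_field n_def field_simps)
  have "D p $ k = (if k = 2 * p + 3 then a2 ^ (p - 2) * ((3 / 2) * a2 ^ 3 + a3 ^ 2 - a2 * a4) else 0)"
    if k: "k < 2 * p + 4" for k
  proof -
    consider "k < 2 * p + 1" | "k = 2 * p + 1" | "k = 2 * p + 2" | "k = 2 * p + 3"
      using k by linarith
    then show ?thesis
      using fps_comp_diff_nth_rec(1)[OF v(1,2), of k p, folded g D_def] D1 D2 D3 by cases auto
  qed
  then show ?thesis
    unfolding fps_cong_iff_nth fps_iterate_CHAR[OF g0 assms(1,3)]
    by (auto simp: fps_X_power_mult_right_nth D_def fps_X_power_iff)
qed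

end
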